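(* Let $p\ge 5$ be a prime, let $r$ be a primitive root modulo $p$, and put $N:=\frac{p+1}{2}$ and $C:=\pi_r D_p$. Then for $i=1,\dots,N-2$ the cosets $C^i=\pi_r^iD_p$ consist of panmagic permutations and are closed under $N$-ary multiplication. Moreover, $$\langle \pi_r,D_p\rangle=\bigcup_{i=1}^{N-1}C^i=\operatorname{Aff}(\mathbb{Z}_p),$$ $D_p$ is a normal subgroup of this group, and the quotient group is $\operatorname{Aff}(\mathbb{Z}_p)/D_p\simeq\mathbb{Z}_{N-1}=\mathbb{Z}_{\frac{p-1}{2}}$.
   Context: $S_n$ is the group of permutations of $\{1,\dots,n\}$, identified with the group of permutations of the residues $\mathbb{Z}_n$ (with $n$ identified with the residue $0$); products are compositions. The permutation matrix of $\sigma\in S_n$ is $P_\sigma$ with $P_\sigma e_i=e_{\sigma(i)}$. The broken diagonals of an $n\times n$ matrix are the sets of positions $(i,j)$ with $i-j\equiv c \pmod n$, and the broken anti-diagonals are the sets of positions with $i+j\equiv c\pmod n$, for constant $c$. A permutation $\sigma\in S_n$ is panmagic if the sum of the entries of $P_\sigma$ over every broken diagonal and every broken anti-diagonal equals $1$ (the common row and column sum). $\phi(i)=n+1-i\equiv 1-i$ is the flip and $\varkappa(i)\equiv i+1\pmod n$ is the cyclic shift; $D_n:=\langle\phi,\varkappa\rangle\le S_n$ is the dihedral group (of permutations). For $a\in\mathbb{Z}_n^\times$ (the units of $\mathbb{Z}_n$) and $b\in\mathbb{Z}_n$, $\pi_{a,b}(i)\equiv ai+b\pmod n$ and $\pi_a:=\pi_{a,0}$;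 $\operatorname{Aff}(\mathbb{Z}_n)=\{\pi_{a,b}\mid a\in\mathbb{Z}_n^\times,\ b\in\mathbb{Z}_n\}$, viewed as a subgroup of $S_n$. For a subset $C$ of a group, $C^i$ denotes the set of all products of $i$ elements of $C$. $C$ is closed under $N$-ary multiplication if $a_1\cdots a_N\in C$ for all $a_1,\dots,a_N\in C$. $\langle S\rangle$ is the subgroup generated by $S$. *)

theory Defs
  imports "HOL-Algebra.Sym_Groups" "HOL-Algebra.Elementary_Groups" "HOL-Number_Theory.Number_Theory"
begin

text \<open>
  Permutations of residues modulo \<open>n\<close> are represented as permutations of \<open>{1..n}\<close>
  (the elements of \<^term>\<open>sym_group n\<close>); the residue class of \<open>0\<close> is represented by \<open>n\<close>.
\<close>

definition residue_rep :: "nat \<Rightarrow> int \<Rightarrow> nat" where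
  "residue_rep n k = (if k mod int n = 0 then n else nat (k mod int n))"

text \<open>Maps given by formulas on \<open>{1..n}\<close> are extended by the identity, as \<open>permutes\<close> requires.\<close>

definition flip_perm :: "nat \<Rightarrow> nat \<Rightarrow> nat" where
  "flip_perm n i = (if i \<in> {1..n} then n + 1 - i else i)"

definition shift_perm :: "nat \<Rightarrow> nat \<Rightarrow> nat" where
  "shift_perm n i = (if i \<in> {1..n} then residue_rep n (int i + 1) else i)"

definition dihedral :: "nat \<Rightarrow> (nat \<Rightarrow> nat) set" where
  "dihedral n = generate (sym_group n) {flip_perm n, shift_perm n}"

definition affine_perm :: "nat \<Rightarrow> int \<Rightarrow> int \<Rightarrow> nat \<Rightarrow> nat" where
  "affine_perm n a b i = (if i \<in> {1..n} then residue_rep n (a * int i + b) else i)"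

text \<open>
  Integer parameters stand for their residue classes modulo \<open>n\<close>; a class is a unit iff its
  representatives are coprime to \<open>n\<close>.
\<close>

definition Aff :: "nat \<Rightarrow> (nat \<Rightarrow> nat) set" where
  "Aff n = {affine_perm n a b | a b. coprime a (int n)}"

text \<open>Row index first: column \<open>j\<close> is the unit vector with index \<open>\<sigma> j\<close>.\<close>

definition perm_matrix :: "(nat \<Rightarrow> nat) \<Rightarrow> nat \<Rightarrow> nat \<Rightarrow> int" where
  "perm_matrix \<sigma> i j = (if i = \<sigma> j then 1 else 0)"

definition broken_diagonal :: "nat \<Rightarrow> int \<Rightarrow> (nat \<times> nat) set" where
  "broken_diagonal n c = {(i, j) \<in> {1..n} \<times> {1..n}. [int i - int j = c] (mod int n)}"

definition broken_antidiagonal :: "nat \<Rightarrow> int \<Rightarrow> (nat \<times> nat) set" where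
  "broken_antidiagonal n c = {(i, j) \<in> {1..n} \<times> {1..n}. [int i + int j = c] (mod int n)}"

definition panmagic :: "nat \<Rightarrow> (nat \<Rightarrow> nat) \<Rightarrow> bool" where
  "panmagic n \<sigma> \<longleftrightarrow> \<sigma> permutes {1..n} \<and>
     (\<forall>c. (\<Sum>(i, j)\<in>broken_diagonal n c. perm_matrix \<sigma> i j) = 1) \<and>
     (\<forall>c. (\<Sum>(i, j)\<in>broken_antidiagonal n c. perm_matrix \<sigma> i j) = 1)"

definition list_product :: "('a, 'b) monoid_scheme \<Rightarrow> 'a list \<Rightarrow> 'a" where
  "list_product G xs = foldr (\<otimes>\<^bsub>G\<^esub>) xs \<one>\<^bsub>G\<^esub>"

definition set_power :: "('a, 'b) monoid_scheme \<Rightarrow> 'a set \<Rightarrow> nat \<Rightarrow> 'a set" where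
  "set_power G C i = {list_product G xs | xs. length xs = i \<and> set xs \<subseteq> C}"

definition closed_under_nary :: "('a, 'b) monoid_scheme \<Rightarrow> nat \<Rightarrow> 'a set \<Rightarrow> bool" where
  "closed_under_nary G N C \<longleftrightarrow>
     (\<forall>xs. length xs = N \<and> set xs \<subseteq> C \<longrightarrow> list_product G xs \<in> C)"

end

theory Submission
  imports Defs
begin

text \<open>
  The slope of an affine map modulo \<open>p\<close> is multiplicative under composition, and \<open>D\<^sub>p\<close> is
  exactly the set of affine maps of slope \<open>\<plusminus>1\<close>: the powers of the shift are the translations,
  and the flip is a reflection. Hence \<open>\<pi>\<^sub>a D\<^sub>p\<close> is the set of all affine maps of slope \<open>\<plusminus>a\<close>,
  called \<open>slope_coset p a\<close> below. These sets multiply like their slopes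
  (\<open>slope_coset_mult\<close>), so everything becomes arithmetic with units of \<open>\<int>\<^sub>p\<close> up to sign.

  Put \<open>M = (p - 1) / 2\<close>, so that \<open>N = M + 1\<close>. A primitive root \<open>r\<close> satisfies \<open>r ^ M \<equiv> - 1\<close>,
  and therefore \<open>r ^ i \<equiv> \<plusminus>r ^ j\<close> iff \<open>i \<equiv> j\<close> modulo \<open>M\<close> (\<open>power_r_cong_pm_iff\<close>). This
  has four consequences.

  \<^item> \<open>C ^ i\<close> is the set of affine maps of slope \<open>\<plusminus>r ^ i\<close>; an \<open>N\<close>-fold product of such maps
    has slope \<open>\<plusminus>r ^ (i * N)\<close>, and \<open>i * N \<equiv> i\<close> modulo \<open>M\<close>.

  \<^item> An affine permutation of slope \<open>a\<close> is panmagic as soon as \<open>a - 1\<close> and \<open>a + 1\<close> are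
    units (\<open>panmagic_affine_perm\<close>), and for \<open>0 < i < M\<close> the slope \<open>r ^ i\<close> is not \<open>\<plusminus>1\<close>.

  \<^item> Every unit is a power of \<open>r\<close>, so the sets \<open>C ^ i\<close> with \<open>1 \<le> i \<le> M\<close> exhaust the affine
    group.

  \<^item> The discrete logarithm of the slope is well defined modulo \<open>M\<close>, and it is a homomorphism
    of the affine group onto \<open>\<int>\<^sub>M\<close> with kernel \<open>D\<^sub>p\<close>. Normality of \<open>D\<^sub>p\<close> and the
    quotient both follow from the first isomorphism theorem.
\<close>

section \<open>Affine maps on residues\<close>

lemma residue_rep_in_range: "n > 0 \<Longrightarrow> residue_rep n k \<in> {1..n}"
  using pos_mod_sign[of "int n" k] pos_mod_bound[of "int n" k]
  unfolding residue_rep_def by (auto simp: Suc_le_eq nat_less_iff order_le_less)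

lemma int_residue_rep_cong: "n > 0 \<Longrightarrow> [int (residue_rep n k) = k] (mod int n)"
  using pos_mod_sign[of "int n" k] unfolding residue_rep_def by (auto simp: cong_def)

lemma residue_rep_cong: "[k = l] (mod int n) \<Longrightarrow> residue_rep n k = residue_rep n l"
  by (simp add: residue_rep_def cong_def)

lemma residue_rep_eq_iff: "n > 0 \<Longrightarrow> residue_rep n k = residue_rep n l \<longleftrightarrow> [k = l] (mod int n)"
  by (metis int_residue_rep_cong residue_rep_cong cong_trans cong_sym)

lemma residue_rep_int: "i \<in> {1..n} \<Longrightarrow> residue_rep n (int i) = i"
  by (cases "i = n") (auto simp: residue_rep_def)

lemma affine_perm_compose:
  assumes "n > 0"
  shows "affine_perm n a b \<circ> affine_perm n c d = affine_perm n (a * c) (a * d + b)"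
proof
  fix i
  show "(affine_perm n a b \<circ> affine_perm n c d) i = affine_perm n (a * c) (a * d + b) i"
  proof (cases "i \<in> {1..n}")
    case True
    have "[a * int (residue_rep n (c * int i + d)) + b = a * (c * int i + d) + b] (mod int n)"
      by (intro cong_add cong_mult cong_refl int_residue_rep_cong assms)
    moreover have "a * (c * int i + d) + b = a * c * int i + (a * d + b)"
      by (simp add: algebra_simps)
    ultimately show ?thesis
      using True residue_rep_in_range[OF assms, of "c * int i + d"]
      by (auto simp: affine_perm_def intro: residue_rep_cong)
  qed (auto simp: affine_perm_def)
qed

lemma affine_perm_cong:
  assumes "[a = c] (mod int n)" "[b = d] (mod int n)"
  shows "affine_perm n a b = affine_perm n c d"
  unfolding affine_perm_def using assms
  by (auto intro!: residue_rep_cong cong_add cong_mult simp: fun_eq_iff)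

text \<open>
  The value at \<open>n\<close>, the representative of \<open>0\<close>, determines the intercept, and the value
  at \<open>1\<close> then determines the slope.
\<close>

lemma affine_perm_eqD:
  assumes "n > 0" "affine_perm n a b = affine_perm n c d"
  shows "[a = c] (mod int n)" and "[b = d] (mod int n)"
proof -
  have "affine_perm n a b n = affine_perm n c d n" "affine_perm n a b 1 = affine_perm n c d 1"
    using assms(2) by simp_all
  then have *: "[a * int n + b = c * int n + d] (mod int n)" "[a + b = c + d] (mod int n)"
    using assms(1) by (auto simp: affine_perm_def residue_rep_eq_iff)
  from *(1) show "[b = d] (mod int n)"
    by (simp add: cong_def)
  from cong_diff[OF *(2) this] show "[a = c] (mod int n)"
    by simp
qed

lemma affine_perm_id: "affine_perm n 1 0 = id"
  by (auto simp: affine_perm_def fun_eq_iff residue_rep_int)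

lemma affine_perm_permutes:
  assumes "n > 0" "coprime a (int n)"
  shows "affine_perm n a b permutes {1..n}"
proof -
  obtain c where c: "[a * c = 1] (mod int n)"
    using cong_solve_coprime_int[OF assms(2)] by blast
  \<comment> \<open>the inverse of \<open>x \<mapsto> a x + b\<close> is \<open>x \<mapsto> c x - c b\<close>\<close>
  have "[a * - (c * b) + b = 0] (mod int n)"
    using cong_diff[OF cong_refl[of b] cong_mult[OF c cong_refl[of b]]] by (simp add: algebra_simps)
  then have "affine_perm n a b \<circ> affine_perm n c (- (c * b)) = affine_perm n 1 0"
    by (simp only: affine_perm_compose[OF assms(1)] affine_perm_cong[OF c])
  moreover have "affine_perm n c (- (c * b)) \<circ> affine_perm n a b = affine_perm n 1 0"
    using c by (simp add: affine_perm_compose assms(1) affine_perm_cong mult.commute)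
  ultimately have "affine_perm n a b \<circ> affine_perm n c (- (c * b)) = id"
    "affine_perm n c (- (c * b)) \<circ> affine_perm n a b = id"
    by (simp_all add: affine_perm_id)
  then have "bij (affine_perm n a b)"
    using o_bij by blast
  then show ?thesis
    by (auto simp: permutes_def affine_perm_def bij_iff)
qed

lemma affine_perm_in_carrier:
  "n > 0 \<Longrightarrow> coprime a (int n) \<Longrightarrow> affine_perm n a b \<in> carrier (sym_group n)"
  unfolding sym_group_carrier by (rule affine_perm_permutes)

lemma Aff_subgroup:
  assumes "n > 0"
  shows "subgroup (Aff n) (sym_group n)"
proof -
  interpret group "sym_group n" by (rule sym_group_is_group)
  show ?thesis
  proof (rule subgroupI)
    show "Aff n \<subseteq> carrier (sym_group n)"
      using affine_perm_permutes[OF assms] by (auto simp: Aff_def sym_group_carrier)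
    have "affine_perm n 1 0 \<in> Aff n"
      unfolding Aff_def using coprime_1_left by blast
    then show "Aff n \<noteq> {}" by blast
  next
    fix \<sigma> assume "\<sigma> \<in> Aff n"
    then obtain a b where \<sigma>: "\<sigma> = affine_perm n a b" and a: "coprime a (int n)"
      by (auto simp: Aff_def)
    obtain c where c: "[c * a = 1] (mod int n)"
      using cong_solve_coprime_int[OF a] by (auto simp: mult.commute)
    then have cop: "coprime c (int n)"
      using coprime_iff_invertible_int by blast
    have "affine_perm n c (- (c * b)) \<circ> \<sigma> = affine_perm n 1 0"
      using c by (simp add: \<sigma> affine_perm_compose assms affine_perm_cong)
    then have "affine_perm n c (- (c * b)) \<circ> \<sigma> = id"
      by (simp only: affine_perm_id)
    then have "inv\<^bsub>sym_group n\<^esub> \<sigma> = affine_perm n c (- (c * b))"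
      using affine_perm_permutes[OF assms a] affine_perm_permutes[OF assms cop]
      by (intro inv_equality) (simp_all only: sym_group_carrier sym_group_mult sym_group_one \<sigma>)
    then show "inv\<^bsub>sym_group n\<^esub> \<sigma> \<in> Aff n"
      using cop by (auto simp: Aff_def)
  next
    fix \<sigma> \<tau> assume "\<sigma> \<in> Aff n" "\<tau> \<in> Aff n"
    then show "\<sigma> \<otimes>\<^bsub>sym_group n\<^esub> \<tau> \<in> Aff n"
      by (auto simp: Aff_def sym_group_mult affine_perm_compose assms) (metis coprime_mult_left_iff)
  qed
qed

section \<open>Panmagic affine permutations\<close>

text \<open>
  Column \<open>j\<close> of a permutation matrix carries its only one in row \<open>\<sigma> j\<close>, so the sum over a set
  of positions counts the columns \<open>j\<close> with \<open>(\<sigma> j, j)\<close> in that set.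
\<close>

lemma sum_perm_matrix:
  assumes "\<sigma> permutes {1..n}"
  shows "(\<Sum>(i, j)\<in>{(i, j) \<in> {1..n} \<times> {1..n}. P i j}. perm_matrix \<sigma> i j)
    = int (card {j \<in> {1..n}. P (\<sigma> j) j})"
proof -
  let ?S = "{(i, j) \<in> {1..n} \<times> {1..n}. P i j}"
  have fin: "finite ?S"
    by (rule finite_subset[of _ "{1..n} \<times> {1..n}"]) auto
  have "(\<Sum>(i, j)\<in>?S. perm_matrix \<sigma> i j) = (\<Sum>x\<in>?S. if x \<in> {x. fst x = \<sigma> (snd x)} then 1 else 0)"
    by (intro sum.cong) (auto simp: perm_matrix_def)
  also have "\<dots> = (\<Sum>x\<in>?S \<inter> {x. fst x = \<sigma> (snd x)}. 1)"
    by (rule sum.inter_restrict[OF fin, symmetric])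
  also have "\<dots> = int (card (?S \<inter> {x. fst x = \<sigma> (snd x)}))"
    by (simp only: sum_constant mult_1_right)
  also have "?S \<inter> {x. fst x = \<sigma> (snd x)} = (\<lambda>j. (\<sigma> j, j)) ` {j \<in> {1..n}. P (\<sigma> j) j}"
    by (auto simp: permutes_in_image[OF assms] simp del: atLeastAtMost_iff One_nat_def)
  also have "card \<dots> = card {j \<in> {1..n}. P (\<sigma> j) j}"
    by (intro card_image) (auto simp: inj_on_def)
  finally show ?thesis .
qed

text \<open>A linear congruence with unit slope has one solution: the affine map is a bijection.\<close>

lemma card_linear_cong:
  assumes "n > 0" "coprime m (int n)"
  shows "card {j \<in> {1..n}. [m * int j + b = c] (mod int n)} = 1"
proof -
  note perm = affine_perm_permutes[OF assms, of b]
  let ?k = "residue_rep n c"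
  have "{j \<in> {1..n}. [m * int j + b = c] (mod int n)} = {j \<in> {1..n}. affine_perm n m b j = ?k}"
    by (auto simp: affine_perm_def residue_rep_eq_iff assms(1))
  also have "\<dots> = {Hilbert_Choice.inv (affine_perm n m b) ?k}"
  proof -
    have "affine_perm n m b j = ?k \<longleftrightarrow> j = Hilbert_Choice.inv (affine_perm n m b) ?k" for j
      unfolding permutes_inv_eq[OF perm, symmetric] by (rule eq_commute)
    moreover have "Hilbert_Choice.inv (affine_perm n m b) ?k \<in> {1..n}"
      unfolding permutes_in_image[OF permutes_inv[OF perm]]
      by (rule residue_rep_in_range[OF assms(1)])
    ultimately show ?thesis by blast
  qed
  finally show ?thesis by simp
qed

text \<open>
  The one in column \<open>j\<close> lies in row \<open>a j + b\<close>, hence on the broken diagonal with index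
  \<open>(a - 1) j + b\<close> and on the broken antidiagonal with index \<open>(a + 1) j + b\<close>. Each index is
  hit once because both slopes are units.
\<close>

lemma panmagic_affine_perm:
  assumes "n > 0" "coprime a (int n)" "coprime (a - 1) (int n)" "coprime (a + 1) (int n)"
  shows "panmagic n (affine_perm n a b)"
proof -
  let ?\<sigma> = "affine_perm n a b"
  note perm = affine_perm_permutes[OF assms(1,2), of b]
  have rep: "[int (?\<sigma> j) = a * int j + b] (mod int n)" if "j \<in> {1..n}" for j
    using that int_residue_rep_cong[OF assms(1)] by (simp add: affine_perm_def)
  have "[int (?\<sigma> j) - int j = c] (mod int n) \<longleftrightarrow> [(a - 1) * int j + b = c] (mod int n)"
    if "j \<in> {1..n}" for j c
    using cong_diff[OF rep[OF that] cong_refl[of "int j"]] by (simp add: cong_def algebra_simps)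
  then have "{j \<in> {1..n}. [int (?\<sigma> j) - int j = c] (mod int n)}
      = {j \<in> {1..n}. [(a - 1) * int j + b = c] (mod int n)}" for c
    by blast
  then have diagonal: "(\<Sum>(i, j)\<in>broken_diagonal n c. perm_matrix ?\<sigma> i j) = 1" for c
    unfolding broken_diagonal_def sum_perm_matrix[OF perm]
    by (simp only: card_linear_cong[OF assms(1,3)] of_nat_1)
  have "[int (?\<sigma> j) + int j = c] (mod int n) \<longleftrightarrow> [(a + 1) * int j + b = c] (mod int n)"
    if "j \<in> {1..n}" for j c
    using cong_add[OF rep[OF that] cong_refl[of "int j"]] by (simp add: cong_def algebra_simps)
  then have "{j \<in> {1..n}. [int (?\<sigma> j) + int j = c] (mod int n)}
      = {j \<in> {1..n}. [(a + 1) * int j + b = c] (mod int n)}" for c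
    by blast
  then have "(\<Sum>(i, j)\<in>broken_antidiagonal n c. perm_matrix ?\<sigma> i j) = 1" for c
    unfolding broken_antidiagonal_def sum_perm_matrix[OF perm]
    by (simp only: card_linear_cong[OF assms(1,4)] of_nat_1)
  with diagonal perm show ?thesis
    by (simp only: panmagic_def simp_thms)
qed

section \<open>Affine maps with prescribed slope up to sign\<close>

text \<open>
  For a unit \<open>a\<close> this is the coset \<open>\<pi>\<^sub>a D\<^sub>n\<close>. Ranging explicitly over signs and intercepts
  makes visible that products of these sets depend only on the slopes.
\<close>

definition slope_coset :: "nat \<Rightarrow> int \<Rightarrow> (nat \<Rightarrow> nat) set" where
  "slope_coset n a = {affine_perm n (s * a) b | s b. s \<in> {1, - 1}}"

lemma slope_cosetI: "affine_perm n a b \<in> slope_coset n a" "affine_perm n (- a) b \<in> slope_coset n a"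
  unfolding slope_coset_def by force+

lemma slope_cosetE:
  assumes "\<sigma> \<in> slope_coset n a"
  obtains s b where "s \<in> {1, - 1}" "\<sigma> = affine_perm n (s * a) b"
  using assms unfolding slope_coset_def by blast

lemma slope_coset_uminus: "slope_coset n (- a) = slope_coset n a"
proof -
  have "slope_coset n (- a) \<subseteq> slope_coset n a" for a
  proof
    fix \<sigma> assume "\<sigma> \<in> slope_coset n (- a)"
    then obtain s b where "s \<in> {1, - 1}" "\<sigma> = affine_perm n (s * (- a)) b"
      by (rule slope_cosetE)
    then show "\<sigma> \<in> slope_coset n a"
      using slope_cosetI[of n a b] by auto
  qed
  from this[of a] this[of "- a"] show ?thesis by simp
qed

lemma slope_coset_cong:
  assumes "[a = c] (mod int n)"
  shows "slope_coset n a = slope_coset n c"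
proof -
  have "affine_perm n (s * a) b = affine_perm n (s * c) b" for s b
    using assms by (intro affine_perm_cong cong_mult cong_refl)
  then show ?thesis by (simp add: slope_coset_def)
qed

lemma affine_perm_in_slope_coset_iff:
  assumes "n > 0"
  shows "affine_perm n a b \<in> slope_coset n c \<longleftrightarrow> [a = c] (mod int n) \<or> [a = - c] (mod int n)"
proof
  assume "affine_perm n a b \<in> slope_coset n c"
  then obtain s d where "s \<in> {1, - 1}" "affine_perm n a b = affine_perm n (s * c) d"
    by (rule slope_cosetE)
  then show "[a = c] (mod int n) \<or> [a = - c] (mod int n)"
    using affine_perm_eqD(1)[OF assms] by fastforce
next
  assume "[a = c] (mod int n) \<or> [a = - c] (mod int n)"
  then have "slope_coset n a = slope_coset n c"
    using slope_coset_cong slope_coset_uminus by metis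
  then show "affine_perm n a b \<in> slope_coset n c"
    using slope_cosetI(1) by blast
qed

text \<open>
  Slopes multiply under composition. Conversely, since every intercept is allowed in the left
  factor, each map of slope \<open>\<plusminus>a c\<close> factors with the linear map \<open>x \<mapsto> c x\<close> on the right.
\<close>

lemma slope_coset_mult:
  assumes "n > 0"
  shows "slope_coset n a <#>\<^bsub>sym_group n\<^esub> slope_coset n c = slope_coset n (a * c)"
proof
  show "slope_coset n a <#>\<^bsub>sym_group n\<^esub> slope_coset n c \<subseteq> slope_coset n (a * c)"
  proof
    fix \<sigma> assume "\<sigma> \<in> slope_coset n a <#>\<^bsub>sym_group n\<^esub> slope_coset n c"
    then obtain \<alpha> \<beta> where "\<sigma> = \<alpha> \<circ> \<beta>" "\<alpha> \<in> slope_coset n a" "\<beta> \<in> slope_coset n c"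
      by (auto simp: set_mult_def sym_group_mult)
    moreover from this obtain s b where "s \<in> {1, - 1}" "\<alpha> = affine_perm n (s * a) b"
      by (elim slope_cosetE)
    moreover from calculation obtain t d where "t \<in> {1, - 1}" "\<beta> = affine_perm n (t * c) d"
      by (elim slope_cosetE)
    ultimately show "\<sigma> \<in> slope_coset n (a * c)"
      using slope_cosetI[of n "a * c"] by (auto simp: affine_perm_compose assms)
  qed
next
  show "slope_coset n (a * c) \<subseteq> slope_coset n a <#>\<^bsub>sym_group n\<^esub> slope_coset n c"
  proof
    fix \<sigma> assume "\<sigma> \<in> slope_coset n (a * c)"
    then obtain s b where s: "s \<in> {1, - 1}" "\<sigma> = affine_perm n (s * (a * c)) b"
      by (rule slope_cosetE)
    then have "\<sigma> = affine_perm n (s * a) b \<circ> affine_perm n c 0"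
      by (simp add: affine_perm_compose assms mult.assoc)
    moreover have "affine_perm n (s * a) b \<in> slope_coset n a"
      using s(1) slope_cosetI by auto
    ultimately show "\<sigma> \<in> slope_coset n a <#>\<^bsub>sym_group n\<^esub> slope_coset n c"
      using slope_cosetI(1)[of n c 0] by (auto simp: set_mult_def sym_group_mult)
  qed
qed

text \<open>
  A single linear map on the left multiplies intercepts by \<open>a\<close>, so here \<open>a\<close> has to be a unit
  for all intercepts to occur.
\<close>

lemma affine_perm_l_coset:
  assumes "n > 0" "coprime a (int n)"
  shows "affine_perm n a 0 <#\<^bsub>sym_group n\<^esub> slope_coset n c = slope_coset n (a * c)"
proof
  show "affine_perm n a 0 <#\<^bsub>sym_group n\<^esub> slope_coset n c \<subseteq> slope_coset n (a * c)"
    using slope_cosetI(1)[of n a 0]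
    unfolding slope_coset_mult[OF assms(1), symmetric] by (auto simp: l_coset_def set_mult_def)
next
  obtain a' where a': "[a * a' = 1] (mod int n)"
    using cong_solve_coprime_int[OF assms(2)] by blast
  show "slope_coset n (a * c) \<subseteq> affine_perm n a 0 <#\<^bsub>sym_group n\<^esub> slope_coset n c"
  proof
    fix \<sigma> assume "\<sigma> \<in> slope_coset n (a * c)"
    then obtain s b where s: "s \<in> {1, - 1}" "\<sigma> = affine_perm n (s * (a * c)) b"
      by (rule slope_cosetE)
    have "[a * (a' * b) = b] (mod int n)"
      using cong_mult[OF a' cong_refl[of b]] by (simp add: mult.assoc)
    then have "affine_perm n a 0 \<circ> affine_perm n (s * c) (a' * b) = \<sigma>"
      by (simp add: s(2) affine_perm_compose assms(1) affine_perm_cong mult.left_commute)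
    moreover have "affine_perm n (s * c) (a' * b) \<in> slope_coset n c"
      using s(1) slope_cosetI by auto
    ultimately show "\<sigma> \<in> affine_perm n a 0 <#\<^bsub>sym_group n\<^esub> slope_coset n c"
      by (auto simp: l_coset_def sym_group_mult)
  qed
qed

section \<open>Linear maps and the dihedral group\<close>

lemma affine_perm_nat_pow:
  assumes "n > 0"
  shows "affine_perm n a 0 [^]\<^bsub>sym_group n\<^esub> (i :: nat) = affine_perm n (a ^ i) 0"
proof -
  interpret group "sym_group n" by (rule sym_group_is_group)
  show ?thesis
    by (induction i)
      (simp_all add: sym_group_one sym_group_mult affine_perm_id affine_perm_compose assms mult.commute)
qed

lemma flip_perm_eq_affine_perm: "flip_perm n = affine_perm n (- 1) 1"
proof
  fix i
  show "flip_perm n i = affine_perm n (- 1) 1 i"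
  proof (cases "i \<in> {1..n}")
    case True
    then have "residue_rep n (- int i + 1) = residue_rep n (int (n + 1 - i))"
      by (intro residue_rep_cong) (simp add: cong_iff_dvd_diff)
    also have "\<dots> = n + 1 - i"
      using True by (intro residue_rep_int) auto
    finally show ?thesis
      using True by (simp add: flip_perm_def affine_perm_def)
  qed (auto simp: flip_perm_def affine_perm_def)
qed

lemma shift_perm_eq_affine_perm: "shift_perm n = affine_perm n 1 1"
  by (simp add: shift_perm_def affine_perm_def fun_eq_iff)

text \<open>
  The powers of the shift are all translations, and composing these with the flip gives all
  maps of slope \<open>- 1\<close>.
\<close>

lemma dihedral_eq_slope_coset:
  assumes "n > 0"
  shows "dihedral n = slope_coset n 1"
proof
  interpret group "sym_group n" by (rule sym_group_is_group)
  have closed: "\<sigma> \<circ> \<tau> \<in> slope_coset n 1" if "\<sigma> \<in> slope_coset n 1" "\<tau> \<in> slope_coset n 1" for \<sigma> \<tau>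
    using that slope_coset_mult[OF assms, of 1 1] by (auto simp: set_mult_def sym_group_mult)
  have gens: "flip_perm n \<in> carrier (sym_group n)" "shift_perm n \<in> carrier (sym_group n)"
    unfolding sym_group_carrier flip_perm_eq_affine_perm shift_perm_eq_affine_perm
    by (simp_all only: affine_perm_permutes assms coprime_1_left coprime_minus_left_iff)
  have inv_flip: "inv\<^bsub>sym_group n\<^esub> (flip_perm n) = affine_perm n (- 1) 1"
    using gens by (intro inv_equality)
      (simp_all add: sym_group_mult sym_group_one flip_perm_eq_affine_perm affine_perm_compose
        assms affine_perm_id)
  have inv_shift: "inv\<^bsub>sym_group n\<^esub> (shift_perm n) = affine_perm n 1 (- 1)"
    using gens by (intro inv_equality)
      (simp_all add: sym_group_mult sym_group_one shift_perm_eq_affine_perm affine_perm_compose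
        assms affine_perm_id affine_perm_in_carrier)
  have gens_in: "flip_perm n \<in> slope_coset n 1" "shift_perm n \<in> slope_coset n 1"
    unfolding flip_perm_eq_affine_perm shift_perm_eq_affine_perm by (rule slope_cosetI)+
  have invs_in: "inv\<^bsub>sym_group n\<^esub> (flip_perm n) \<in> slope_coset n 1"
    "inv\<^bsub>sym_group n\<^esub> (shift_perm n) \<in> slope_coset n 1"
    unfolding inv_flip inv_shift by (rule slope_cosetI)+
  show "dihedral n \<subseteq> slope_coset n 1"
    unfolding dihedral_def
  proof (intro subsetI)
    fix \<sigma> assume "\<sigma> \<in> generate (sym_group n) {flip_perm n, shift_perm n}"
    then show "\<sigma> \<in> slope_coset n 1"
    proof induction
      case one
      then show ?case
        using slope_cosetI(1)[of n 1 0] by (simp only: sym_group_one affine_perm_id)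
    next
      case (eng \<sigma> \<tau>)
      then show ?case using closed by (simp only: sym_group_mult)
    qed (use gens_in invs_in in auto)
  qed
  have mult: "\<sigma> \<circ> \<tau> \<in> dihedral n" if "\<sigma> \<in> dihedral n" "\<tau> \<in> dihedral n" for \<sigma> \<tau>
    using that generate.eng[of _ "sym_group n"] by (auto simp: dihedral_def sym_group_mult)
  have translation_nat: "affine_perm n 1 (int k) \<in> dihedral n" for k
  proof (induction k)
    case 0
    then show ?case
      using generate.one[of "sym_group n"] unfolding dihedral_def of_nat_0 affine_perm_id sym_group_one .
  next
    case (Suc k)
    have "shift_perm n \<circ> affine_perm n 1 (int k) \<in> dihedral n"
      by (intro mult Suc) (simp add: dihedral_def generate.incl)
    then show ?case
      by (simp add: shift_perm_eq_affine_perm affine_perm_compose assms add.commute)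
  qed
  have translation: "affine_perm n 1 b \<in> dihedral n" for b
  proof -
    have "affine_perm n 1 b = affine_perm n 1 (int (nat (b mod int n)))"
      using assms by (intro affine_perm_cong) (simp_all add: cong_def)
    then show ?thesis by (simp only: translation_nat)
  qed
  have "affine_perm n (- 1) b \<in> dihedral n" for b
  proof -
    have "affine_perm n 1 (b - 1) \<circ> flip_perm n \<in> dihedral n"
      by (intro mult translation) (simp add: dihedral_def generate.incl)
    then show ?thesis
      by (simp add: flip_perm_eq_affine_perm affine_perm_compose assms)
  qed
  with translation show "slope_coset n 1 \<subseteq> dihedral n"
    by (auto elim!: slope_cosetE)
qed

section \<open>Powers of subsets\<close>

lemma set_power_0: "set_power G C 0 = {\<one>\<^bsub>G\<^esub>}"
  by (simp add: set_power_def list_product_def)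

lemma set_power_Suc: "set_power G C (Suc i) = C <#>\<^bsub>G\<^esub> set_power G C i"
proof
  show "set_power G C (Suc i) \<subseteq> C <#>\<^bsub>G\<^esub> set_power G C i"
    by (auto simp: set_power_def set_mult_def list_product_def length_Suc_conv) blast
next
  have "x \<otimes>\<^bsub>G\<^esub> list_product G xs \<in> set_power G C (Suc i)"
    if "x \<in> C" "length xs = i" "set xs \<subseteq> C" for x xs
    unfolding set_power_def using that
    by (intro CollectI exI[of _ "x # xs"]) (simp add: list_product_def)
  then show "C <#>\<^bsub>G\<^esub> set_power G C i \<subseteq> set_power G C (Suc i)"
    by (auto simp: set_mult_def set_power_def[of _ _ i])
qed

lemma closed_under_nary_iff: "closed_under_nary G m C \<longleftrightarrow> set_power G C m \<subseteq> C"
  by (auto simp: closed_under_nary_def set_power_def)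

text \<open>
  The exponent \<open>0\<close> has to be excluded: the empty product is only the identity, while
  \<open>slope_coset n 1\<close> contains all translations.
\<close>

lemma set_power_slope_coset:
  assumes "n > 0" "i > 0"
  shows "set_power (sym_group n) (slope_coset n a) i = slope_coset n (a ^ i)"
  using assms(2)
proof (induction i rule: nat_induct_non_zero)
  case 1
  then show ?case
    by (simp only: One_nat_def set_power_Suc set_power_0)
      (simp add: set_mult_def sym_group_mult sym_group_one)
next
  case (Suc i)
  then show ?case by (simp add: set_power_Suc slope_coset_mult assms(1))
qed

section \<open>Discrete logarithms of slopes\<close>

locale odd_prime_primitive_root =
  fixes p r :: nat
  assumes prime_p: "prime p" and p_gt_2: "p > 2" and primroot: "residue_primroot p r"
begin

text \<open>The order of \<open>r\<close> in the group of units modulo \<open>\<plusminus>1\<close>.\<close>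

definition M :: nat where "M = (p - 1) div 2"

lemma p_pos: "p > 0"
  using p_gt_2 by simp

lemma twice_M: "2 * M = p - 1"
  using prime_odd_nat[OF prime_p p_gt_2] by (simp add: M_def)

lemma M_pos: "M > 0"
  using twice_M p_gt_2 by simp

lemma ord_r: "ord p r = 2 * M"
  using primroot prime_p by (simp add: residue_primroot_def totient_prime twice_M)

lemma coprime_power_r: "coprime (int r ^ i) (int p)"
  using primroot by (simp add: residue_primroot_def coprime_commute)

lemma power_r_cong_iff: "[int r ^ i = int r ^ j] (mod int p) \<longleftrightarrow> [i = j] (mod 2 * M)"
  using order_divides_expdiff[of p r i j] primroot
  by (simp add: ord_r residue_primroot_def cong_int_iff flip: of_nat_power)

lemma power_l_coset_dihedral:
  "(affine_perm p (int r) 0 [^]\<^bsub>sym_group p\<^esub> i) <#\<^bsub>sym_group p\<^esub> dihedral p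
    = slope_coset p (int r ^ i)" for i :: nat
  by (simp only: affine_perm_nat_pow[OF p_pos] dihedral_eq_slope_coset[OF p_pos]
      affine_perm_l_coset[OF p_pos coprime_power_r] mult_1_right)

text \<open>The square of \<open>r ^ M\<close> is \<open>1\<close> by Fermat, while \<open>r ^ M\<close> itself is not, so it is \<open>- 1\<close>.\<close>

lemma power_r_M: "[int r ^ M = - 1] (mod int p)"
proof -
  have "[int r ^ (2 * M) = int r ^ 0] (mod int p)"
    unfolding power_r_cong_iff by (simp add: cong_def)
  moreover have "int r ^ (2 * M) - int r ^ 0 = (int r ^ M - 1) * (int r ^ M + 1)"
    by (simp only: mult_2 power_add power_0) (simp add: algebra_simps)
  ultimately have "int p dvd (int r ^ M - 1) * (int r ^ M + 1)"
    by (simp only: cong_iff_dvd_diff)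
  moreover have "\<not> [int r ^ M = int r ^ 0] (mod int p)"
    unfolding power_r_cong_iff using M_pos by (auto simp: cong_def)
  ultimately show ?thesis
    using prime_p by (simp add: cong_iff_dvd_diff prime_dvd_mult_iff)
qed

text \<open>Powers of \<open>r\<close> agree up to sign iff their exponents agree modulo \<open>M\<close>, as \<open>- 1\<close> is \<open>r ^ M\<close>.\<close>

lemma power_r_cong_pm_iff:
  "[int r ^ i = int r ^ j] (mod int p) \<or> [int r ^ i = - (int r ^ j)] (mod int p)
    \<longleftrightarrow> [i = j] (mod M)"
proof -
  have "[int r ^ (j + M) = - (int r ^ j)] (mod int p)"
    using cong_mult[OF cong_refl[of "int r ^ j"] power_r_M] by (simp add: power_add)
  then have "[int r ^ i = - (int r ^ j)] (mod int p) \<longleftrightarrow> [i = j + M] (mod 2 * M)"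
    unfolding power_r_cong_iff[symmetric] by (meson cong_sym cong_trans)
  moreover have "[i = j] (mod 2 * M) \<or> [i = j + M] (mod 2 * M) \<longleftrightarrow> [i = j] (mod M)"
  proof
    assume "[i = j] (mod 2 * M) \<or> [i = j + M] (mod 2 * M)"
    then have "[i = j] (mod M) \<or> [i = j + M] (mod M)"
      using cong_dvd_modulus_nat dvd_triv_right by blast
    then show "[i = j] (mod M)" by (simp add: cong_def)
  next
    assume "[i = j] (mod M)"
    then have "int M dvd int i - int j"
      by (simp add: cong_iff_dvd_diff flip: cong_int_iff)
    then obtain k where k: "int i - int j = int M * k" ..
    show "[i = j] (mod 2 * M) \<or> [i = j + M] (mod 2 * M)"
    proof (cases "even k")
      case True
      then have "int (2 * M) dvd int i - int j"
        unfolding k by (auto elim!: evenE)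
      then show ?thesis by (simp add: cong_iff_dvd_diff flip: cong_int_iff)
    next
      case False
      then obtain l where "k = 2 * l + 1" by (rule oddE)
      then have "int i - int (j + M) = int (2 * M) * l"
        using k by (simp add: algebra_simps)
      then have "[i = j + M] (mod 2 * M)"
        unfolding cong_int_iff[symmetric] cong_iff_dvd_diff by simp
      then show ?thesis ..
    qed
  qed
  ultimately show ?thesis by (simp add: power_r_cong_iff)
qed

lemma slope_coset_power_r_cong:
  assumes "[i = j] (mod M)"
  shows "slope_coset p (int r ^ i) = slope_coset p (int r ^ j)"
proof -
  consider "[int r ^ i = int r ^ j] (mod int p)" | "[int r ^ i = - (int r ^ j)] (mod int p)"
    using assms power_r_cong_pm_iff by blast
  then show ?thesis
    by cases (simp_all only: slope_coset_cong[of "int r ^ i"] slope_coset_uminus)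
qed

text \<open>Different exponents modulo \<open>M\<close> give disjoint sets, which makes the discrete logarithm well defined.\<close>

lemma slope_coset_power_r_unique:
  assumes "\<sigma> \<in> slope_coset p (int r ^ i)" "\<sigma> \<in> slope_coset p (int r ^ j)"
  shows "[i = j] (mod M)"
proof -
  obtain s b where s: "s \<in> {1, - 1}" "\<sigma> = affine_perm p (s * int r ^ i) b"
    using assms(1) by (rule slope_cosetE)
  then have "[s * int r ^ i = int r ^ j] (mod int p) \<or> [s * int r ^ i = - (int r ^ j)] (mod int p)"
    using assms(2) by (simp add: affine_perm_in_slope_coset_iff p_pos)
  then have "[int r ^ i = int r ^ j] (mod int p) \<or> [int r ^ i = - (int r ^ j)] (mod int p)"
    using s(1) cong_minus_minus_iff[of "int r ^ i" _ "int p"]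
    by (metis insertE minus_minus mult_1 mult_minus1 singletonD)
  then show ?thesis by (simp only: power_r_cong_pm_iff)
qed

lemma Aff_eq_Union_slope_coset: "Aff p = (\<Union>i\<in>{1..M}. slope_coset p (int r ^ i))"
proof
  show "Aff p \<subseteq> (\<Union>i\<in>{1..M}. slope_coset p (int r ^ i))"
  proof
    fix \<sigma> assume "\<sigma> \<in> Aff p"
    then obtain a b where \<sigma>: "\<sigma> = affine_perm p a b" and a: "coprime a (int p)"
      by (auto simp: Aff_def)
    let ?k = "nat (a mod int p)"
    have "int ?k = a mod int p"
      using p_pos by simp
    moreover have "coprime (a mod int p) (int p)"
      using a p_pos by simp
    ultimately have "coprime ?k p"
      by (metis coprime_int_iff)
    moreover from this have "?k \<noteq> 0"
      using p_gt_2 by (intro notI) simp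
    moreover have "?k < p"
      using p_pos by (simp add: nat_less_iff)
    ultimately have "?k \<in> totatives p"
      by (simp add: totatives_def)
    then have "?k \<in> (\<lambda>i. r ^ i mod p) ` {..<totient p}"
      using residue_primroot_is_generator[OF _ primroot] p_gt_2 by (simp add: bij_betw_def)
    then obtain j where "r ^ j mod p = ?k"
      by force
    then have "int r ^ j mod int p = a mod int p"
      using \<open>int ?k = _\<close> by (metis of_nat_mod of_nat_power)
    then have "slope_coset p (int r ^ j) = slope_coset p a"
      by (intro slope_coset_cong) (simp add: cong_def)
    then have "\<sigma> \<in> slope_coset p (int r ^ j)"
      using slope_cosetI(1) \<sigma> by simp
    \<comment> \<open>the exponents \<open>1, \<dots>, M\<close> are representatives modulo \<open>M\<close>, with \<open>M\<close> in place of \<open>0\<close>\<close>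
    moreover have "[j = residue_rep M (int j)] (mod M)"
      using int_residue_rep_cong[OF M_pos, of "int j"] by (simp add: cong_int_iff cong_sym)
    ultimately have "\<sigma> \<in> slope_coset p (int r ^ residue_rep M (int j))"
      using slope_coset_power_r_cong by blast
    then show "\<sigma> \<in> (\<Union>i\<in>{1..M}. slope_coset p (int r ^ i))"
      using residue_rep_in_range[OF M_pos, of "int j"] by blast
  qed
next
  show "(\<Union>i\<in>{1..M}. slope_coset p (int r ^ i)) \<subseteq> Aff p"
  proof safe
    fix i \<sigma> assume "\<sigma> \<in> slope_coset p (int r ^ i)"
    then obtain s b where "s \<in> {1, - 1}" "\<sigma> = affine_perm p (s * int r ^ i) b"
      by (rule slope_cosetE)
    moreover from this have "coprime (s * int r ^ i) (int p)"
      using coprime_power_r[of i] by auto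
    ultimately show "\<sigma> \<in> Aff p"
      unfolding Aff_def by blast
  qed
qed

text \<open>For these \<open>i\<close> the slope is not \<open>\<plusminus>1\<close>, so it stays a unit when shifted by \<open>1\<close> in either direction.\<close>

lemma panmagic_slope_coset:
  assumes "i \<in> {1..M - 1}" "\<sigma> \<in> slope_coset p (int r ^ i)"
  shows "panmagic p \<sigma>"
proof -
  obtain s b where s: "s \<in> {1, - 1}" "\<sigma> = affine_perm p (s * int r ^ i) b"
    using assms(2) by (rule slope_cosetE)
  have "\<not> [i = 0] (mod M)"
    using assms(1) by (auto simp: cong_def)
  then have "\<not> int p dvd int r ^ i - 1" "\<not> int p dvd int r ^ i + 1"
    unfolding power_r_cong_pm_iff[symmetric] by (simp_all add: cong_iff_dvd_diff)
  then have "coprime (int p) (int r ^ i - 1)" "coprime (int p) (int r ^ i + 1)"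
    using prime_p by (simp_all add: prime_imp_coprime)
  then have "coprime (int r ^ i - 1) (int p)" "coprime (int r ^ i + 1) (int p)"
    by (simp_all only: coprime_commute)
  moreover from this have "coprime (- (int r ^ i) - 1) (int p)" "coprime (- (int r ^ i) + 1) (int p)"
    using coprime_minus_left_iff[of "int r ^ i + 1" "int p"]
      coprime_minus_left_iff[of "int r ^ i - 1" "int p"] by simp_all
  ultimately have "coprime (s * int r ^ i - 1) (int p)" "coprime (s * int r ^ i + 1) (int p)"
    using s(1) by auto
  moreover have "coprime (s * int r ^ i) (int p)"
    using s(1) coprime_power_r[of i] by auto
  ultimately show ?thesis
    unfolding s(2) by (intro panmagic_affine_perm p_pos)
qed

lemma generate_eq_Aff:
  "generate (sym_group p) (insert (affine_perm p (int r) 0) (dihedral p)) = Aff p"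
  (is "generate _ ?S = _")
proof
  interpret group "sym_group p" by (rule sym_group_is_group)
  let ?\<rho> = "affine_perm p (int r) 0"
  have S: "?S \<subseteq> Aff p"
  proof -
    have "affine_perm p (int r) 0 \<in> Aff p"
      unfolding Aff_def using coprime_power_r[of 1] by auto
    moreover have "slope_coset p 1 \<subseteq> Aff p"
    proof
      fix \<sigma> assume "\<sigma> \<in> slope_coset p 1"
      then obtain s b where "s \<in> {1, - 1}" "\<sigma> = affine_perm p (s * 1) b"
        by (rule slope_cosetE)
      moreover from this have "coprime (s * 1) (int p)" by auto
      ultimately show "\<sigma> \<in> Aff p" unfolding Aff_def by blast
    qed
    ultimately show ?thesis
      by (simp add: dihedral_eq_slope_coset p_pos)
  qed
  then show "generate (sym_group p) ?S \<subseteq> Aff p"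
    by (rule generate_subgroup_incl) (rule Aff_subgroup[OF p_pos])
  have "?S \<subseteq> carrier (sym_group p)"
    using S subgroup.subset[OF Aff_subgroup[OF p_pos]] by blast
  then interpret gen: subgroup "generate (sym_group p) ?S" "sym_group p"
    by (rule generate_is_subgroup)
  have pow: "?\<rho> [^]\<^bsub>sym_group p\<^esub> i \<in> generate (sym_group p) ?S" for i :: nat
    by (induction i) (simp_all add: generate.incl gen.m_closed)
  show "Aff p \<subseteq> generate (sym_group p) ?S"
    unfolding Aff_eq_Union_slope_coset
  proof safe
    fix i \<sigma> assume "\<sigma> \<in> slope_coset p (int r ^ i)"
    then have "\<sigma> \<in> (?\<rho> [^]\<^bsub>sym_group p\<^esub> i) <#\<^bsub>sym_group p\<^esub> dihedral p"
      by (simp only: power_l_coset_dihedral)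
    then obtain d where "d \<in> dihedral p" "\<sigma> = ?\<rho> [^]\<^bsub>sym_group p\<^esub> i \<otimes>\<^bsub>sym_group p\<^esub> d"
      by (auto simp: l_coset_def)
    then show "\<sigma> \<in> generate (sym_group p) ?S"
      using pow by (simp add: generate.incl gen.m_closed)
  qed
qed

text \<open>
  The discrete logarithm to base \<open>r\<close> of the slope, taken modulo \<open>M\<close> because the slope matters
  only up to sign. The choice of the exponent is immaterial by \<open>slope_coset_power_r_unique\<close>.
\<close>

definition slope_log :: "(nat \<Rightarrow> nat) \<Rightarrow> int" where
  "slope_log \<sigma> = int ((SOME i. \<sigma> \<in> slope_coset p (int r ^ i)) mod M)"

lemma slope_log_eq:
  assumes "\<sigma> \<in> slope_coset p (int r ^ i)"
  shows "slope_log \<sigma> = int (i mod M)"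
proof -
  have "\<sigma> \<in> slope_coset p (int r ^ (SOME i. \<sigma> \<in> slope_coset p (int r ^ i)))"
    using assms by (rule someI)
  from slope_coset_power_r_unique[OF this assms] show ?thesis
    by (simp add: slope_log_def cong_def)
qed

lemma slope_log_hom:
  "group_hom ((sym_group p)\<lparr>carrier := Aff p\<rparr>) (integer_mod_group M) slope_log"
proof -
  interpret group "sym_group p" by (rule sym_group_is_group)
  have "slope_log \<in> hom ((sym_group p)\<lparr>carrier := Aff p\<rparr>) (integer_mod_group M)"
  proof (rule homI)
    fix \<sigma> assume "\<sigma> \<in> carrier ((sym_group p)\<lparr>carrier := Aff p\<rparr>)"
    show "slope_log \<sigma> \<in> carrier (integer_mod_group M)"
      using M_pos by (simp add: carrier_integer_mod_group slope_log_def)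
  next
    fix \<sigma> \<tau>
    assume "\<sigma> \<in> carrier ((sym_group p)\<lparr>carrier := Aff p\<rparr>)"
      and "\<tau> \<in> carrier ((sym_group p)\<lparr>carrier := Aff p\<rparr>)"
    then obtain i j where
      ij: "\<sigma> \<in> slope_coset p (int r ^ i)" "\<tau> \<in> slope_coset p (int r ^ j)"
      by (auto simp: Aff_eq_Union_slope_coset)
    then have "\<sigma> \<circ> \<tau> \<in> slope_coset p (int r ^ (i + j))"
      unfolding power_add slope_coset_mult[OF p_pos, symmetric]
      by (auto simp: set_mult_def sym_group_mult)
    then show "slope_log (\<sigma> \<otimes>\<^bsub>(sym_group p)\<lparr>carrier := Aff p\<rparr>\<^esub> \<tau>)
        = slope_log \<sigma> \<otimes>\<^bsub>integer_mod_group M\<^esub> slope_log \<tau>"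
      using slope_log_eq[OF ij(1)] slope_log_eq[OF ij(2)] slope_log_eq[of "\<sigma> \<circ> \<tau>"]
      by (simp add: sym_group_mult of_nat_mod mod_simps)
  qed
  then show ?thesis
    using subgroup.subgroup_is_group[OF Aff_subgroup[OF p_pos]] sym_group_is_group
    by (simp add: group_hom_def group_hom_axioms_def)
qed

text \<open>
  Logarithm \<open>0\<close> modulo \<open>M\<close> means slope \<open>\<plusminus>1\<close>. The exponent \<open>M\<close> stands for \<open>0\<close> in the proof,
  since the affine group is covered by the exponents \<open>1, \<dots>, M\<close>.
\<close>

lemma kernel_slope_log:
  "kernel ((sym_group p)\<lparr>carrier := Aff p\<rparr>) (integer_mod_group M) slope_log = dihedral p"
proof -
  have "\<sigma> \<in> Aff p \<and> slope_log \<sigma> = 0 \<longleftrightarrow> \<sigma> \<in> slope_coset p (int r ^ M)" for \<sigma>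
  proof
    assume "\<sigma> \<in> Aff p \<and> slope_log \<sigma> = 0"
    then obtain i where i: "\<sigma> \<in> slope_coset p (int r ^ i)" and "slope_log \<sigma> = 0"
      by (auto simp: Aff_eq_Union_slope_coset)
    then have "[i = M] (mod M)"
      by (simp add: slope_log_eq cong_def)
    then show "\<sigma> \<in> slope_coset p (int r ^ M)"
      using i slope_coset_power_r_cong by blast
  next
    assume *: "\<sigma> \<in> slope_coset p (int r ^ M)"
    then show "\<sigma> \<in> Aff p \<and> slope_log \<sigma> = 0"
      using slope_log_eq[OF *] M_pos by (auto simp: Aff_eq_Union_slope_coset)
  qed
  moreover have "slope_coset p (int r ^ M) = slope_coset p 1"
    using slope_coset_power_r_cong[of M 0] by (simp add: cong_def)
  ultimately show ?thesis
    by (auto simp: kernel_def dihedral_eq_slope_coset p_pos)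
qed

lemma slope_log_surj: "slope_log ` Aff p = carrier (integer_mod_group M)"
proof
  show "slope_log ` Aff p \<subseteq> carrier (integer_mod_group M)"
    using M_pos by (auto simp: slope_log_def carrier_integer_mod_group)
next
  show "carrier (integer_mod_group M) \<subseteq> slope_log ` Aff p"
  proof
    fix k assume k: "k \<in> carrier (integer_mod_group M)"
    let ?\<sigma> = "affine_perm p (int r ^ nat k) 0"
    have "slope_log ?\<sigma> = int (nat k mod M)"
      by (intro slope_log_eq slope_cosetI)
    then have "slope_log ?\<sigma> = k"
      using k M_pos by (simp add: carrier_integer_mod_group nat_less_iff)
    moreover have "?\<sigma> \<in> Aff p"
      unfolding Aff_def using coprime_power_r by blast
    ultimately show "k \<in> slope_log ` Aff p" by force
  qed
qed

end

section \<open>Powers of the coset of a primitive root\<close>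

theorem theorem4:
  fixes p r N :: nat
    and \<rho> :: "nat \<Rightarrow> nat"
    and C :: "(nat \<Rightarrow> nat) set"
  assumes "prime p" and "p \<ge> 5"
    and "residue_primroot p r"
    and "N = (p + 1) div 2"
    and "\<rho> = affine_perm p (int r) 0"
    and "C = \<rho> <#\<^bsub>sym_group p\<^esub> dihedral p"
  shows "(\<forall>i\<in>{1..N - 2}.
            set_power (sym_group p) C i = (\<rho> [^]\<^bsub>sym_group p\<^esub> i) <#\<^bsub>sym_group p\<^esub> dihedral p \<and>
            (\<forall>\<sigma>\<in>set_power (sym_group p) C i. panmagic p \<sigma>) \<and>
            closed_under_nary (sym_group p) N (set_power (sym_group p) C i)) \<and>
         generate (sym_group p) (insert \<rho> (dihedral p)) =
           (\<Union>i\<in>{1..N - 1}. set_power (sym_group p) C i) \<and>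
         (\<Union>i\<in>{1..N - 1}. set_power (sym_group p) C i) = Aff p \<and>
         dihedral p \<lhd> (sym_group p)\<lparr>carrier := Aff p\<rparr> \<and>
         (sym_group p)\<lparr>carrier := Aff p\<rparr> Mod dihedral p \<cong> integer_mod_group (N - 1) \<and>
         N - 1 = (p - 1) div 2"
proof -
  interpret odd_prime_primitive_root p r
    using assms by unfold_locales auto
  have N: "N - 1 = M" "N - 2 = M - 1" "N = M + 1"
    using assms(4) twice_M p_gt_2 by (simp_all add: M_def)
  note \<rho> = power_l_coset_dihedral[folded assms(5)]
  have "C = slope_coset p (int r)"
    using affine_perm_l_coset[OF p_pos coprime_power_r[of 1], of 1]
    by (simp add: assms(5,6) dihedral_eq_slope_coset p_pos)
  then have C: "set_power (sym_group p) C i = slope_coset p (int r ^ i)" if "i > 0" for i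
    using that by (simp add: set_power_slope_coset p_pos)
  have "closed_under_nary (sym_group p) N (slope_coset p (int r ^ i))" for i
  proof -
    \<comment> \<open>an \<open>N\<close>-fold product multiplies the exponent by \<open>N\<close>, and \<open>N\<close> is \<open>1\<close> modulo \<open>M\<close>\<close>
    have "[i * N = i] (mod M)"
      by (simp add: N(3) cong_def algebra_simps)
    then have "slope_coset p ((int r ^ i) ^ N) = slope_coset p (int r ^ i)"
      using slope_coset_power_r_cong by (simp only: power_mult[symmetric])
    moreover have "N > 0"
      by (simp add: N(3))
    ultimately show ?thesis
      by (simp only: closed_under_nary_iff set_power_slope_coset[OF p_pos] order_refl)
  qed
  moreover have "(\<Union>i\<in>{1..N - 1}. set_power (sym_group p) C i) = Aff p"
    by (simp add: C N Aff_eq_Union_slope_coset)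
  moreover have "dihedral p \<lhd> (sym_group p)\<lparr>carrier := Aff p\<rparr>"
    using group_hom.normal_kernel[OF slope_log_hom] by (simp add: kernel_slope_log)
  moreover have "(sym_group p)\<lparr>carrier := Aff p\<rparr> Mod dihedral p \<cong> integer_mod_group (N - 1)"
    using group_hom.FactGroup_iso[OF slope_log_hom] by (simp add: kernel_slope_log slope_log_surj N)
  moreover have "N - 1 = (p - 1) div 2"
    by (simp add: N M_def)
  ultimately show ?thesis
    using panmagic_slope_coset by (simp add: C \<rho> generate_eq_Aff[folded assms(5)] N)
qed

end
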